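(* Let $$a_1=\bigl(12960+864\sqrt{105}\bigr)^{1/6},\quad a_2=\bigl(12960-864\sqrt{105}\bigr)^{1/6},$$ $$b_1=\bigl(1425-139\sqrt{105}\bigr)^{1/6},\quad b_2=\bigl(1425+139\sqrt{105}\bigr)^{1/6},\quad b_3=26250^{1/6},$$ and let $c_k=\cos(\tfrac{2\pi}{5}k)$, $s_k=\sin(\tfrac{2\pi}{5}k)$ for $0\le k\le 4$. Then the $11$ vectors in $\mathbb{R}^3$ $$(a_1c_k,\,a_1s_k,\,b_1),\quad (a_2c_k,\,a_2s_k,\,-b_2)\quad (0\le k\le 4),\qquad (0,0,-b_3)$$ form a spherical $(3,3)$-design for $\mathbb{R}^3$. The corresponding sum of powers formula is: for all $x,y,z\in\mathbb{R}$, $$\sum_{j=0}^1\sum_{k=0}^4\bigl(\alpha_j(c_kx+s_ky)+\beta_jz\bigr)^6+26250\,z^6=40500\,(x^2+y^2+z^2)^3,$$ where $$\alpha_j=\bigl(12960+(-1)^j864\sqrt{105}\bigr)^{1/6},\qquad \beta_j=(-1)^j\bigl(1425-(-1)^j139\sqrt{105}\bigr)^{1/6}.$$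
   Context: All sixth roots are the positive real sixth roots of positive real numbers. For $t\in\{1,2,\ldots\}$, a sequence of vectors $v_1,\ldots,v_n\in\mathbb{R}^d$, not all zero, is a spherical $(t,t)$-design for $\mathbb{R}^d$ if $$\sum_{j=1}^n\sum_{k=1}^n |\langle v_j,v_k\rangle|^{2t} = \frac{1\cdot 3\cdot 5\cdots(2t-1)}{d(d+2)\cdots(d+2(t-1))}\Bigl(\sum_{\ell=1}^n\|v_\ell\|^{2t}\Bigr)^2 .$$ The vectors are not required to have equal norms. *)

theory Defs
  imports "HOL-Analysis.Analysis"
begin

(* The design is a finite sequence, so it is a list: order is irrelevant, but
   repeated vectors count with multiplicity. *)
definition spherical_tt_design :: "nat \<Rightarrow> (real ^ 'd) list \<Rightarrow> bool" where
  "spherical_tt_design t vs \<longleftrightarrow>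
     t \<ge> 1 \<and> (\<exists>v \<in> set vs. v \<noteq> 0) \<and>
     (\<Sum>j<length vs. \<Sum>k<length vs. \<bar>(vs ! j) \<bullet> (vs ! k)\<bar> ^ (2 * t)) =
       (\<Prod>i<t. 2 * real i + 1) / (\<Prod>i<t. real CARD('d) + 2 * real i) *
       (\<Sum>l<length vs. norm (vs ! l) ^ (2 * t)) ^ 2"

end

theory Submission
  imports Defs
begin

text \<open>
  Write a vector of the design as \<open>(\<alpha> c\<^sub>k, \<alpha> s\<^sub>k, \<beta>)\<close>. The sixth powers of its inner products with
  \<open>(x, y, z)\<close>, summed over the five vertices of a regular pentagon, are a polynomial in \<open>z\<close> whose
  coefficients are power sums of the linear forms \<open>c\<^sub>k x + s\<^sub>k y\<close>. A power sum of exponent below 5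
  cannot see the difference between a pentagon and the full circle, so it is a multiple of a power
  of \<open>x\<^sup>2 + y\<^sup>2\<close> (and zero for odd exponent); so is the sixth one, because the frequencies it contains
  are even and at most 6, hence divisible by 5 only when they vanish. Only the fifth power sum
  contains a non-radial term, a multiple of \<open>Re ((x + \<i> y)^5)\<close>. All this is
  \<open>pentagon_sixth_powers\<close>.

  Two parallel pentagons together with a vector on the axis therefore give
  \<open>40500 (x\<^sup>2 + y\<^sup>2 + z\<^sup>2)\<^sup>3\<close> as soon as five scalar equations hold. Those for \<open>x\<^sup>6\<close> and \<open>z\<^sup>6\<close> are visible
  from the radicals. Those for the mixed radial terms amount to \<open>\<Sum> \<alpha>\<^sup>2 \<beta>\<^sup>4 = 3240\<close> and
  \<open>\<Sum> \<alpha>\<^sup>4 \<beta>\<^sup>2 = 4320\<close>, and hold because the sixth roots occurring there combine to conjugate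
  elements of the field generated by \<open>sqrt 105\<close> (\<open>radical_products\<close>). The last one, \<open>a\<^sub>1\<^sup>5 b\<^sub>1 = a\<^sub>2\<^sup>5 b\<^sub>2\<close>, makes the
  non-radial terms of the two pentagons cancel, the pentagons lying on opposite sides of the
  plane \<open>z = 0\<close>.

  Finally, such a sum of powers formula implies the design property: evaluating it at every vector
  of the system and adding up gives the double sum, with the correct factor provided the constant
  of the formula is the mean that the definition prescribes (\<open>design_if_power_sum_formula\<close>).
\<close>

section \<open>Designs from sums of powers\<close>

lemma design_if_power_sum_formula:
  fixes vs :: "(real ^ 'd) list"
  assumes "t \<ge> 1" and "\<exists>v \<in> set vs. v \<noteq> 0"
    and formula: "\<And>u. (\<Sum>v\<leftarrow>vs. (v \<bullet> u) ^ (2 * t)) = C * norm u ^ (2 * t)"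
    and mean: "C = (\<Prod>i<t. 2 * real i + 1) / (\<Prod>i<t. real CARD('d) + 2 * real i) *
       (\<Sum>v\<leftarrow>vs. norm v ^ (2 * t))"
  shows "spherical_tt_design t vs"
proof -
  have "(\<Sum>j<length vs. \<Sum>k<length vs. \<bar>(vs ! j) \<bullet> (vs ! k)\<bar> ^ (2 * t))
      = (\<Sum>k<length vs. \<Sum>j<length vs. ((vs ! j) \<bullet> (vs ! k)) ^ (2 * t))"
    by (subst sum.swap) (simp add: power_even_abs)
  also have "\<dots> = (\<Sum>k<length vs. C * norm (vs ! k) ^ (2 * t))"
    using formula by (simp add: sum_list_sum_nth atLeast0LessThan)
  also have "\<dots> = C * (\<Sum>l<length vs. norm (vs ! l) ^ (2 * t))"
    by (simp add: sum_distrib_left)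
  finally show ?thesis
    using assms(1,2)
    by (simp add: spherical_tt_design_def mean sum_list_sum_nth atLeast0LessThan power2_eq_square)
qed

section \<open>Sixth powers over a regular pentagon\<close>

text \<open>
  For \<open>\<theta> = 2 \<pi> / 5\<close> one has \<open>cos (3 \<theta>) = cos (2 \<theta>)\<close>, a cubic equation for \<open>cos \<theta>\<close>; dividing out the
  root 1, which belongs to \<open>\<theta> = 0\<close>, leaves this quadratic one.
\<close>

lemma cos_2pi_div_5: "4 * cos (2 * pi / 5) ^ 2 + 2 * cos (2 * pi / 5) = 1"
proof -
  define c where "c = cos (2 * pi / 5)"
  have "cos (3 * (2 * pi / 5)) = cos (2 * pi - 2 * (2 * pi / 5))"
    by (simp add: field_simps)
  also have "\<dots> = cos (2 * (2 * pi / 5))"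
    by (simp only: cos_2pi_minus)
  finally have "4 * c ^ 3 - 3 * c = 2 * c\<^sup>2 - 1"
    by (simp only: cos_treble_cos cos_double_cos c_def)
  then have "(c - 1) * (4 * c\<^sup>2 + 2 * c - 1) = 0"
    by algebra
  moreover have "c < cos 0"
    unfolding c_def by (rule cos_monotone_0_pi) (auto simp: pi_gt_zero)
  ultimately show ?thesis
    by (simp add: c_def)
qed

text \<open>
  The shift \<open>w\<close> makes this a generating identity for the power sums of the pentagon up to exponent
  6. All five vertices are polynomials in \<open>c = cos (2 \<pi> / 5)\<close> and \<open>s = sin (2 \<pi> / 5)\<close>, so that it
  becomes an identity modulo the quadratic equation of \<open>c\<close> and \<open>s\<^sup>2 + c\<^sup>2 = 1\<close>.
\<close>

lemma pentagon_sixth_powers: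
  fixes x y w :: real
  shows "(\<Sum>k=0..4. (cos (2 * pi / 5 * real k) * x + sin (2 * pi / 5 * real k) * y + w) ^ 6)
    = 5 * w ^ 6 + 75 / 2 * (x\<^sup>2 + y\<^sup>2) * w ^ 4 + 225 / 8 * (x\<^sup>2 + y\<^sup>2)\<^sup>2 * w\<^sup>2
      + 15 / 8 * (x ^ 5 - 10 * x ^ 3 * y\<^sup>2 + 5 * x * y ^ 4) * w + 25 / 16 * (x\<^sup>2 + y\<^sup>2) ^ 3"
proof -
  let ?\<theta> = "2 * pi / 5"
  define c s where "c = cos ?\<theta>" and "s = sin ?\<theta>"
  have c: "4 * c\<^sup>2 + 2 * c = 1" and s: "s\<^sup>2 + c\<^sup>2 = 1"
    using cos_2pi_div_5 by (simp_all add: c_def s_def)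
  have 2: "cos (?\<theta> * 2) = 2 * c\<^sup>2 - 1" "sin (?\<theta> * 2) = 2 * s * c"
    using cos_double_cos[of ?\<theta>] sin_double[of ?\<theta>] by (simp_all only: c_def s_def mult.commute)
  have refl: "?\<theta> * 3 = 2 * pi - ?\<theta> * 2" "?\<theta> * 4 = 2 * pi - ?\<theta>"
    by simp_all
  have 3: "cos (?\<theta> * 3) = 2 * c\<^sup>2 - 1" "sin (?\<theta> * 3) = - (2 * s * c)"
    and 4: "cos (?\<theta> * 4) = c" "sin (?\<theta> * 4) = - s"
    by (simp_all only: refl cos_2pi_minus sin_2pi_minus 2) (simp_all add: c_def s_def)
  have "{0..4::nat} = {0, 1, 2, 3, 4}"
    by auto
  then have "(\<Sum>k=0..4. (cos (?\<theta> * real k) * x + sin (?\<theta> * real k) * y + w) ^ 6)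
    = (x + w) ^ 6 + (c * x + s * y + w) ^ 6 + ((2 * c\<^sup>2 - 1) * x + 2 * s * c * y + w) ^ 6
      + ((2 * c\<^sup>2 - 1) * x - 2 * s * c * y + w) ^ 6 + (c * x - s * y + w) ^ 6"
    by (simp add: 2[simplified] 3[simplified] 4[simplified] c_def[symmetric] s_def[symmetric])
  also have "\<dots> = 5 * w ^ 6 + 75 / 2 * (x\<^sup>2 + y\<^sup>2) * w ^ 4 + 225 / 8 * (x\<^sup>2 + y\<^sup>2)\<^sup>2 * w\<^sup>2
      + 15 / 8 * (x ^ 5 - 10 * x ^ 3 * y\<^sup>2 + 5 * x * y ^ 4) * w + 25 / 16 * (x\<^sup>2 + y\<^sup>2) ^ 3"
    using c s by algebra
  finally show ?thesis .
qed

section \<open>The radicals\<close>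

text \<open>
  These are the relations behind the choice of radicals: with \<open>p = 15 + sqrt 105\<close> and
  \<open>r = 15 - sqrt 105\<close> one has \<open>p r = 120\<close>, \<open>a\<^sub>1\<^sup>6 = 864 p\<close> and \<open>b\<^sub>1\<^sup>6 = r\<^sup>5 / 3600\<close>; the second pentagon
  exchanges \<open>p\<close> and \<open>r\<close>. Cubing the mixed products turns them into monomials in \<open>a\<^sup>6\<close> and \<open>b\<^sup>6\<close>, and
  after cancelling \<open>p\<close> against \<open>r\<close> the result is visibly a cube. The third product is symmetric
  in \<open>p\<close> and \<open>r\<close>, hence equal for both pentagons.
\<close>

lemma radical_products:
  fixes a b p r :: real
  assumes a: "a ^ 6 = 864 * p" and b: "b ^ 6 = r ^ 5 / 3600" and pr: "p * r = 120"
  shows "a\<^sup>2 * b ^ 4 = r ^ 3 / 5" and "a ^ 4 * b\<^sup>2 = 144 * r"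
    and "(a ^ 5 * b) ^ 6 = (864 * 120) ^ 5 / 3600"
proof -
  have cube_inject: "x = y" if "x ^ 3 = y ^ 3" for x y :: real
    by (metis that odd_real_root_power_cancel odd_numeral)
  have "(a\<^sup>2 * b ^ 4) ^ 3 = a ^ 6 * (b ^ 6)\<^sup>2"
    by algebra
  also have "\<dots> = 864 / 3600\<^sup>2 * (p * r) * r ^ 9"
    unfolding a b by (simp add: power2_eq_square power_numeral_reduce)
  also have "\<dots> = (r ^ 3 / 5) ^ 3"
    unfolding pr by (simp add: power_divide flip: power_mult)
  finally show "a\<^sup>2 * b ^ 4 = r ^ 3 / 5"
    by (rule cube_inject)
  have "(a ^ 4 * b\<^sup>2) ^ 3 = (a ^ 6)\<^sup>2 * b ^ 6"
    by algebra
  also have "\<dots> = 864\<^sup>2 / 3600 * (p * r)\<^sup>2 * r ^ 3"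
    unfolding a b by (simp add: power2_eq_square power_numeral_reduce)
  also have "\<dots> = (144 * r) ^ 3"
    unfolding pr by (simp add: power_mult_distrib)
  finally show "a ^ 4 * b\<^sup>2 = 144 * r"
    by (rule cube_inject)
  have "(a ^ 5 * b) ^ 6 = (a ^ 6) ^ 5 * b ^ 6"
    by algebra
  also have "\<dots> = (864 * (p * r)) ^ 5 / 3600"
    unfolding a b by (simp add: power_mult_distrib)
  finally show "(a ^ 5 * b) ^ 6 = (864 * 120) ^ 5 / 3600"
    unfolding pr .
qed

section \<open>The design of eleven vectors\<close>

theorem mainTheorem2:
  fixes a1 a2 b1 b2 b3 :: real
    and c s \<alpha> \<beta> :: "nat \<Rightarrow> real"
  assumes "a1 = root 6 (12960 + 864 * sqrt 105)"
    and "a2 = root 6 (12960 - 864 * sqrt 105)"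
    and "b1 = root 6 (1425 - 139 * sqrt 105)"
    and "b2 = root 6 (1425 + 139 * sqrt 105)"
    and "b3 = root 6 26250"
    and "\<And>k. c k = cos (2 * pi / 5 * real k)"
    and "\<And>k. s k = sin (2 * pi / 5 * real k)"
    and "\<And>j. \<alpha> j = root 6 (12960 + (-1) ^ j * 864 * sqrt 105)"
    and "\<And>j. \<beta> j = (-1) ^ j * root 6 (1425 - (-1) ^ j * 139 * sqrt 105)"
  shows "spherical_tt_design 3
           (map (\<lambda>k. vector [a1 * c k, a1 * s k, b1] :: real ^ 3) [0..<5] @
            map (\<lambda>k. vector [a2 * c k, a2 * s k, - b2]) [0..<5] @
            [vector [0, 0, - b3]]) \<and>
         (\<forall>x y z :: real.
           (\<Sum>j=0..1. \<Sum>k=0..4. (\<alpha> j * (c k * x + s k * y) + \<beta> j * z) ^ 6) + 26250 * z ^ 6 =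
             40500 * (x ^ 2 + y ^ 2 + z ^ 2) ^ 3)"
proof -
  define q where "q = sqrt 105"
  have q: "q\<^sup>2 = 105"
    by (simp add: q_def)
  have powers: "(15 - q) ^ 3 = 8100 - 780 * q" "(15 + q) ^ 3 = 8100 + 780 * q"
    "(15 - q) ^ 5 = 3600 * (1425 - 139 * q)" "(15 + q) ^ 5 = 3600 * (1425 + 139 * q)"
    and conj: "(15 + q) * (15 - q) = 120" "(15 - q) * (15 + q) = 120"
  proof -
    have qq: "q * q = 105" "q * (q * x) = 105 * x" for x
      using q by (simp_all add: power2_eq_square flip: mult.assoc)
    show "(15 - q) ^ 3 = 8100 - 780 * q" "(15 + q) ^ 3 = 8100 + 780 * q"
      "(15 - q) ^ 5 = 3600 * (1425 - 139 * q)" "(15 + q) ^ 5 = 3600 * (1425 + 139 * q)"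
      "(15 + q) * (15 - q) = 120" "(15 - q) * (15 + q) = 120"
      by (simp_all add: eval_nat_numeral algebra_simps qq)
  qed
  have "0 \<le> q" "q \<le> 15"
    using real_sqrt_le_mono[of 105 "15\<^sup>2"] by (simp_all add: q_def)
  then have "0 \<le> (15 - q) ^ 5" "0 \<le> 15 - q"
    by simp_all
  then have a1: "a1 ^ 6 = 12960 + 864 * q" "a1 \<ge> 0"
    and a2: "a2 ^ 6 = 12960 - 864 * q" "a2 \<ge> 0"
    and b1: "b1 ^ 6 = 1425 - 139 * q" "b1 \<ge> 0"
    and b2: "b2 ^ 6 = 1425 + 139 * q" "b2 \<ge> 0"
    and b3: "b3 ^ 6 = 26250"
    using \<open>0 \<le> q\<close> by (simp_all add: assms(1-5) powers(3) q_def[symmetric])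
  have products1: "a1\<^sup>2 * b1 ^ 4 = (15 - q) ^ 3 / 5" "a1 ^ 4 * b1\<^sup>2 = 144 * (15 - q)"
      "(a1 ^ 5 * b1) ^ 6 = (864 * 120) ^ 5 / 3600"
    by (rule radical_products[OF _ _ conj(1)]; simp add: a1 b1 powers)+
  have products2: "a2\<^sup>2 * b2 ^ 4 = (15 + q) ^ 3 / 5" "a2 ^ 4 * b2\<^sup>2 = 144 * (15 + q)"
      "(a2 ^ 5 * b2) ^ 6 = (864 * 120) ^ 5 / 3600"
    by (rule radical_products[OF _ _ conj(2)]; simp add: a2 b2 powers)+
  have mixed1: "a1\<^sup>2 * b1 ^ 4 = 1620 - 156 * q" "a1 ^ 4 * b1\<^sup>2 = 2160 - 144 * q"
    and mixed2: "a2\<^sup>2 * b2 ^ 4 = 1620 + 156 * q" "a2 ^ 4 * b2\<^sup>2 = 2160 + 144 * q"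
    unfolding products1 products2 powers by simp_all
  have fifth: "a1 ^ 5 * b1 = a2 ^ 5 * b2"
    by (rule power_eq_imp_eq_base[of _ 6]) (use products1(3) products2(3) a1 a2 b1 b2 in auto)
  have pentagon: "(\<Sum>k=0..4. (a * (c k * x + s k * y) + b * z) ^ 6)
    = 5 * b ^ 6 * z ^ 6 + 75 / 2 * (a\<^sup>2 * b ^ 4) * (x\<^sup>2 + y\<^sup>2) * z ^ 4
      + 225 / 8 * (a ^ 4 * b\<^sup>2) * (x\<^sup>2 + y\<^sup>2)\<^sup>2 * z\<^sup>2
      + 15 / 8 * (a ^ 5 * b) * (x ^ 5 - 10 * x ^ 3 * y\<^sup>2 + 5 * x * y ^ 4) * z
      + 25 / 16 * a ^ 6 * (x\<^sup>2 + y\<^sup>2) ^ 3" for a b x y z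
  proof -
    have "(\<Sum>k=0..4. (a * (c k * x + s k * y) + b * z) ^ 6)
      = (\<Sum>k=0..4. (cos (2 * pi / 5 * real k) * (a * x) + sin (2 * pi / 5 * real k) * (a * y) + b * z) ^ 6)"
      by (simp add: assms(6,7) algebra_simps)
    then show ?thesis
      unfolding pentagon_sixth_powers by algebra
  qed
  have formula: "(\<Sum>k=0..4. (a1 * (c k * x + s k * y) + b1 * z) ^ 6)
      + (\<Sum>k=0..4. (a2 * (c k * x + s k * y) + (- b2) * z) ^ 6) + 26250 * z ^ 6
    = 40500 * (x\<^sup>2 + y\<^sup>2 + z\<^sup>2) ^ 3" for x y z
  proof -
    have signs: "(- b2) ^ 6 = b2 ^ 6" "(- b2) ^ 4 = b2 ^ 4" "(- b2)\<^sup>2 = b2\<^sup>2"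
      "a2 ^ 5 * - b2 = - (a1 ^ 5 * b1)"
      by (simp_all add: fifth)
    show ?thesis
      unfolding pentagon signs mixed1 mixed2 a1(1) a2(1) b1(1) b2(1) by algebra
  qed
  have "\<alpha> 0 = a1" "\<beta> 0 = b1" "\<alpha> 1 = a2" "\<beta> 1 = - b2"
    by (simp_all add: assms(1-4,8,9))
  then have "(\<Sum>j=0..1. \<Sum>k=0..4. (\<alpha> j * (c k * x + s k * y) + \<beta> j * z) ^ 6) + 26250 * z ^ 6 =
      40500 * (x\<^sup>2 + y\<^sup>2 + z\<^sup>2) ^ 3" for x y z
    using formula[of x y z] by simp
  moreover have "spherical_tt_design 3
     (map (\<lambda>k. vector [a1 * c k, a1 * s k, b1] :: real ^ 3) [0..<5] @
      map (\<lambda>k. vector [a2 * c k, a2 * s k, - b2]) [0..<5] @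
      [vector [0, 0, - b3]])" (is "spherical_tt_design 3 ?vs")
  proof (rule design_if_power_sum_formula)
    have "b3 \<noteq> 0"
      using b3 by auto
    then have "vector [0, 0, - b3] \<noteq> (0 :: real ^ 3)"
      by (simp add: vec_eq_iff forall_3)
    then show "\<exists>v \<in> set ?vs. v \<noteq> 0"
      by auto
    have sum_map: "(\<Sum>v\<leftarrow>?vs. f v) = (\<Sum>k=0..4. f (vector [a1 * c k, a1 * s k, b1]))
      + (\<Sum>k=0..4. f (vector [a2 * c k, a2 * s k, - b2])) + f (vector [0, 0, - b3])"
      for f :: "real ^ 3 \<Rightarrow> real"
      by (simp add: o_def interv_sum_list_conv_sum_set_nat atLeastLessThanSuc_atLeastAtMost
          eval_nat_numeral flip: add.assoc)
    have norm6: "norm u ^ (2 * 3) = ((u $ 1)\<^sup>2 + (u $ 2)\<^sup>2 + (u $ 3)\<^sup>2) ^ 3" for u :: "real ^ 3"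
      unfolding power_mult power2_norm_eq_inner
      by (simp add: inner_vec_def sum_3 power2_eq_square)
    show "(\<Sum>v\<leftarrow>?vs. (v \<bullet> u) ^ (2 * 3)) = 40500 * norm u ^ (2 * 3)" for u
      unfolding sum_map norm6 formula[symmetric]
      by (simp add: inner_vec_def sum_3 power_mult_distrib b3 distrib_left mult.assoc)
    have "(\<Sum>v\<leftarrow>?vs. norm v ^ (2 * 3)) = 5 * (a1\<^sup>2 + b1\<^sup>2) ^ 3 + 5 * (a2\<^sup>2 + b2\<^sup>2) ^ 3 + b3 ^ 6"
    proof -
      have "(a * c k)\<^sup>2 + (a * s k)\<^sup>2 = a\<^sup>2" for a k
        by (simp add: assms(6,7) power_mult_distrib flip: distrib_left)
      then show ?thesis
        unfolding sum_map norm6 by simp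
    qed
    also have "\<dots> = 283500"
    proof -
      have binomial: "(a\<^sup>2 + b\<^sup>2) ^ 3 = a ^ 6 + 3 * (a ^ 4 * b\<^sup>2) + 3 * (a\<^sup>2 * b ^ 4) + b ^ 6" for a b :: real
        by algebra
      show ?thesis
        unfolding binomial mixed1 mixed2 a1(1) a2(1) b1(1) b2(1) b3 by simp
    qed
    finally show "40500 = (\<Prod>i<3. 2 * real i + 1) / (\<Prod>i<3. real CARD(3) + 2 * real i) *
       (\<Sum>v\<leftarrow>?vs. norm v ^ (2 * 3))"
      by (simp add: eval_nat_numeral)
  qed simp
  ultimately show ?thesis
    by blast
qed

end
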